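(* Let $k\ge 2$ be a constant, $\beta>2$, and let $\Phi$ be a random $k$-SAT formula on $n$ variables with $m$ clauses, $r=\tfrac mn$, whose variable distribution is given by the concrete power law weights with exponent $\beta$. Let $N\in\mathbb{N}^+$ be any constant. Then $\Phi$ is with high probability unsatisfiable if \[\left(1-\tfrac{1}{2^k}\right)^r 2^{\frac 1N}\prod_{l=1}^{N-1}\left[2-\exp\left(-(1+o(1))\,r\,\frac{k}{2^k-1}\cdot\frac{\beta-2}{\beta-1}\left(\frac{N}{l}\right)^{\frac{1}{\beta-1}}\right)\right]^{\frac 1N}<1.\]
   Context: Random $k$-SAT model: given $n$ Boolean variables, $m$ clauses and a probability distribution $\vec p$ on $\{1,\dots,n\}$, the formula is the conjunction of $m$ independently sampled clauses; each clause is sampled by selecting $k$ variables independently from $\vec p$, repeating until no two coincide, and negating each independently with probability $1/2$. The distribution is given by weights via $p_i=w_i/\sum_j w_j$. The concrete power law weights with exponent $\beta$ are $w_{n-i+1}:=(n/i)^{1/(\beta-1)}$ for $i=1,\dots,n$. Asymptotics as $n\to\infty$; "with high probability" means with probability $1-O(n^{-\delta})$ for some $\delta>0$. *)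

theory Defs
  imports "HOL-Probability.Probability" "HOL-Library.Landau_Symbols"
begin

(* Variables are natural numbers; the literal (v, s) is the variable v if s, and its negation
   otherwise.  A clause lists its literals (disjunction), a formula its clauses (conjunction),
   so repeated clauses are kept. *)

type_synonym literal = "nat \<times> bool"
type_synonym clause = "literal list"
type_synonym cnf = "clause list"

definition satisfies :: "(nat \<Rightarrow> bool) \<Rightarrow> cnf \<Rightarrow> bool" where
  "satisfies \<alpha> \<Phi> \<longleftrightarrow> (\<forall>c\<in>set \<Phi>. \<exists>(v, s)\<in>set c. \<alpha> v = s)"

definition satisfiable :: "cnf \<Rightarrow> bool" where
  "satisfiable \<Phi> \<longleftrightarrow> (\<exists>\<alpha>. satisfies \<alpha> \<Phi>)"

definition var_pmf :: "nat \<Rightarrow> (nat \<Rightarrow> real) \<Rightarrow> nat pmf" where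
  "var_pmf n w = embed_pmf (\<lambda>i. if i \<in> {1..n} then w i / (\<Sum>j=1..n. w j) else 0)"

lemma pmf_var_pmf:
  assumes "n \<ge> 1" and "\<And>i. i \<in> {1..n} \<Longrightarrow> w i > 0"
  shows "pmf (var_pmf n w) i = (if i \<in> {1..n} then w i / (\<Sum>j=1..n. w j) else 0)"
proof -
  define W where "W = (\<Sum>j=1..n. w j)"
  define f where "f = (\<lambda>i. if i \<in> {1..n} then w i / W else 0)"
  have pos: "W > 0"
    unfolding W_def using assms by (intro sum_pos) auto
  have nonneg: "f i \<ge> 0" for i
    unfolding f_def using assms(2)[of i] pos by (metis divide_pos_pos less_imp_le order_refl)
  have "(\<integral>\<^sup>+i. ennreal (f i) \<partial>count_space UNIV) = (\<Sum>i\<in>{1..n}. ennreal (f i))"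
    by (rule nn_integral_count_space'[where A = "{1..n}"]) (auto simp: f_def)
  also have "\<dots> = ennreal (\<Sum>i\<in>{1..n}. f i)"
    by (rule sum_ennreal) (rule nonneg)
  also have "(\<Sum>i\<in>{1..n}. f i) = (\<Sum>i\<in>{1..n}. w i) / W"
    unfolding sum_divide_distrib by (rule sum.cong) (simp_all add: f_def)
  also have "\<dots> = 1"
    using pos unfolding W_def by (metis divide_self less_irrefl)
  finally have "pmf (embed_pmf f) i = f i"
    by (intro pmf_embed_pmf nonneg) simp
  then show ?thesis
    unfolding var_pmf_def f_def W_def .
qed

lemma set_var_pmf:
  assumes "n \<ge> 1" and "\<And>i. i \<in> {1..n} \<Longrightarrow> w i > 0"
  shows "set_pmf (var_pmf n w) = {1..n}"
proof -
  define W where "W = (\<Sum>j=1..n. w j)"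
  have pos: "W > 0"
    unfolding W_def using assms by (intro sum_pos) auto
  have eq: "pmf (var_pmf n w) i = (if i \<in> {1..n} then w i / W else 0)" for i
    unfolding W_def by (rule pmf_var_pmf) (fact assms)+
  have "pmf (var_pmf n w) i \<noteq> 0 \<longleftrightarrow> i \<in> {1..n}" for i
    unfolding eq using pos assms(2)[of i] by (metis divide_pos_pos less_irrefl)
  then show ?thesis
    unfolding set_pmf_eq by blast
qed

(* Redrawing the k variables until no two of them coincide amounts to conditioning on
   distinctness; for k \<le> n and positive weights the conditioning event has positive
   probability, see vars_pmf_cond_nonempty. *)
definition vars_pmf :: "nat \<Rightarrow> nat pmf \<Rightarrow> nat list pmf" where
  "vars_pmf k p = cond_pmf (replicate_pmf k p) {vs. distinct vs}"

lemma vars_pmf_cond_nonempty: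
  assumes "k \<le> n" "1 \<le> n" and "\<And>i. i \<in> {1..n} \<Longrightarrow> w i > 0"
  shows "set_pmf (replicate_pmf k (var_pmf n w)) \<inter> {vs. distinct vs} \<noteq> {}"
proof -
  have eq: "set_pmf (var_pmf n w) = {1..n}"
    by (rule set_var_pmf) (fact assms)+
  have "set [1..<Suc k] \<subseteq> {1..n}"
    unfolding set_upt using assms(1) by auto
  moreover have "length [1..<Suc k] = k"
    unfolding length_upt by simp
  ultimately have "[1..<Suc k] \<in> set_pmf (replicate_pmf k (var_pmf n w))"
    unfolding set_replicate_pmf eq lists_eq_set by blast
  with distinct_upt show ?thesis
    by blast
qed

definition clause_pmf :: "nat \<Rightarrow> nat pmf \<Rightarrow> clause pmf" where
  "clause_pmf k p = do {
     vs \<leftarrow> vars_pmf k p;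
     ss \<leftarrow> replicate_pmf k (bernoulli_pmf (1/2));
     return_pmf (zip vs ss)
   }"

definition ksat_pmf :: "nat \<Rightarrow> nat \<Rightarrow> nat \<Rightarrow> (nat \<Rightarrow> real) \<Rightarrow> cnf pmf" where
  "ksat_pmf k n m w = replicate_pmf m (clause_pmf k (var_pmf n w))"

(* Reindexed by j = n - i + 1, so that the natural subtraction n + 1 - j is the rank i. *)
definition power_law_weight :: "real \<Rightarrow> nat \<Rightarrow> nat \<Rightarrow> real" where
  "power_law_weight \<beta> n j = (real n / real (n + 1 - j)) powr (1 / (\<beta> - 1))"

lemma power_law_weight_pos: "j \<in> {1..n} \<Longrightarrow> power_law_weight \<beta> n j > 0"
proof -
  assume "j \<in> {1..n}"
  then have "real n > 0" "real (n + 1 - j) > 0"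
    by (simp_all only: atLeastAtMost_iff of_nat_0_less_iff) linarith+
  then have "real n / real (n + 1 - j) > 0"
    by (rule divide_pos_pos)
  then show ?thesis
    unfolding power_law_weight_def by (metis less_irrefl powr_gt_zero)
qed

definition whp :: "(nat \<Rightarrow> real) \<Rightarrow> bool" where
  "whp P \<longleftrightarrow> (\<exists>\<delta>>0. (\<lambda>n. 1 - P n) \<in> O(\<lambda>n. real n powr (- \<delta>)))"

end

theory Submission
  imports Defs "HOL-Real_Asymp.Real_Asymp"
begin

text \<open>
  First moment method for locally maximal solutions: a satisfiable formula has a satisfying
  assignment with as few false variables as possible, and then every false variable is blocked,
  i.e. setting it to true falsifies some clause. A clause that holds under a given assignment blocks at
  most one variable, so the blocked variables behave like occupied bins and the probability that
  all false variables are blocked is at most the product of the individual probabilities. Summing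
  over all assignments bounds the probability of satisfiability by
  \<open>(1 - 2\<^sup>-\<^sup>k)\<^sup>m \<Prod>\<^sub>i (2 - (1 - b\<^sub>i)\<^sup>m)\<close>, where \<open>b\<^sub>i\<close> is the probability that a true clause blocks \<open>i\<close>.

  The factors are monotone in the rank, so cutting the ranks into \<open>N\<close> blocks gives the stated
  expression. It is only assumed to be below 1, with no gap. The gap comes from the block of the heaviest
  variables, which the expression bounds by 2 per variable: on half of that block the factors stay
  below 2 by a constant. This constant vanishes for large \<open>r\<close>, but there the trivial
  bound \<open>2\<^sup>n (1 - 2\<^sup>-\<^sup>k)\<^sup>m\<close> suffices.
\<close>

section \<open>Probabilities under bind and independent repetition\<close>

lemma integrable_prob [simp]:
  "integrable (measure_pmf p) (\<lambda>x. measure_pmf.prob (f x) (A x))"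
  by (rule measure_pmf.integrable_const_bound[where B = 1]) auto

lemma integrable_indicator_pmf:
  "integrable (measure_pmf p) (indicator A :: _ \<Rightarrow> real)"
  by (rule measure_pmf.integrable_const_bound[where B = 1]) (auto simp: indicator_def)

lemma prob_bind_pmf:
  "measure_pmf.prob (bind_pmf p f) A = (\<integral>x. measure_pmf.prob (f x) A \<partial>measure_pmf p)"
  unfolding measure_pmf_bind
  by (rule measure_pmf.measure_bind[where N = "count_space UNIV"])
     (auto simp: space_subprob_algebra intro: prob_space_imp_subprob_space measure_pmf.prob_space_axioms)

lemma prob_replicate_pmf_Suc:
  "measure_pmf.prob (replicate_pmf (Suc m) p) A =
   (\<integral>c. measure_pmf.prob (replicate_pmf m p) {cs. c # cs \<in> A} \<partial>measure_pmf p)"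
proof -
  have "replicate_pmf (Suc m) p = bind_pmf p (\<lambda>c. map_pmf ((#) c) (replicate_pmf m p))"
    by (simp add: map_pmf_def)
  then show ?thesis
    by (simp only: prob_bind_pmf measure_map_pmf vimage_def)
qed

section \<open>Occupancy of disjoint bins\<close>

text \<open>Expanded over subsets of \<open>T\<close>, the right-hand product contains every term on
  the left, and the terms with two or more factors \<open>y i\<close> are nonnegative. In the
  application \<open>x i\<close> stands for a bin hit by \<open>m\<close> balls and
  \<open>y i\<close> for the gain from one more ball.\<close>

lemma prod_add_first_order_le:
  fixes x y :: "'a \<Rightarrow> real"
  assumes "finite T" "\<And>i. i \<in> T \<Longrightarrow> 0 \<le> x i" "\<And>i. i \<in> T \<Longrightarrow> 0 \<le> y i"
  shows "(\<Prod>i\<in>T. x i) + (\<Sum>i\<in>T. y i * (\<Prod>j\<in>T - {i}. x j)) \<le> (\<Prod>i\<in>T. x i + y i)"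
  using assms
proof (induction T rule: finite_induct)
  case (insert a T)
  have eq: "(\<Sum>i\<in>T. y i * (\<Prod>j\<in>insert a T - {i}. x j)) = x a * (\<Sum>i\<in>T. y i * (\<Prod>j\<in>T - {i}. x j))"
    unfolding sum_distrib_left
  proof (rule sum.cong)
    fix i assume "i \<in> T"
    then have "insert a T - {i} = insert a (T - {i})" "a \<notin> T - {i}" using insert by auto
    then show "y i * (\<Prod>j\<in>insert a T - {i}. x j) = x a * (y i * (\<Prod>j\<in>T - {i}. x j))"
      using insert by simp
  qed simp
  have IH: "(\<Prod>i\<in>T. x i) + (\<Sum>i\<in>T. y i * (\<Prod>j\<in>T - {i}. x j)) \<le> (\<Prod>i\<in>T. x i + y i)"
    using insert by auto
  have le: "(\<Prod>i\<in>T. x i) \<le> (\<Prod>i\<in>T. x i + y i)"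
    using insert by (intro prod_mono) auto
  have "x a * ((\<Prod>i\<in>T. x i) + (\<Sum>i\<in>T. y i * (\<Prod>j\<in>T - {i}. x j))) + y a * (\<Prod>i\<in>T. x i)
     \<le> x a * (\<Prod>i\<in>T. x i + y i) + y a * (\<Prod>i\<in>T. x i + y i)"
    using insert IH le by (intro add_mono mult_left_mono) auto
  moreover have "insert a T - {a} = T" using insert by auto
  ultimately show ?case
    using insert by (simp add: eq algebra_simps)
qed simp

text \<open>The bound is the product one would get if the events were independent; only this direction of
  the negative correlation of bin occupancies is needed, and it survives induction on the number of balls.\<close>

lemma prob_all_bins_hit_le:
  fixes p :: "'c pmf" and B :: "'i \<Rightarrow> 'c set" and s :: real
  assumes "finite T" "disjoint_family_on B T" "\<And>i. i \<in> T \<Longrightarrow> B i \<subseteq> S"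
    and "0 \<le> s" "measure_pmf.prob p S \<le> s"
    and "\<And>i. i \<in> T \<Longrightarrow> 0 \<le> b i" "\<And>i. i \<in> T \<Longrightarrow> b i \<le> 1"
    and "\<And>i. i \<in> T \<Longrightarrow> measure_pmf.prob p (B i) \<le> s * b i"
  shows "measure_pmf.prob (replicate_pmf m p) {cs. set cs \<subseteq> S \<and> (\<forall>i\<in>T. set cs \<inter> B i \<noteq> {})}
           \<le> s ^ m * (\<Prod>i\<in>T. 1 - (1 - b i) ^ m)"
  using assms(1-3,6-8)
\<comment> \<open>\<open>T\<close> stays general because a ball landing in bin \<open>j\<close>
  leaves only \<open>T - {j}\<close> to be hit.\<close>
proof (induction m arbitrary: T)
  case 0
  then show ?case by (cases "T = {}") auto
next
  case (Suc m)
  define x where "x i = 1 - (1 - b i) ^ m" for i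
  define X where "X U = s ^ m * (\<Prod>i\<in>U. x i)" for U
  define E where "E U = {cs. set cs \<subseteq> S \<and> (\<forall>i\<in>U. set cs \<inter> B i \<noteq> {})}" for U
  have x01: "0 \<le> x i" "x i \<le> 1" if "i \<in> T" for i
    using Suc.prems(4,5)[OF that] by (auto simp: x_def power_le_one)
  have IH: "measure_pmf.prob (replicate_pmf m p) (E U) \<le> X U" if "U \<subseteq> T" for U
    unfolding E_def X_def x_def
    using that Suc.prems by (intro Suc.IH) (auto intro: finite_subset disjoint_family_on_mono)
  \<comment> \<open>Dropping a bin only raises the bound. This keeps the coefficients of the bin
    probabilities nonnegative, so that each of these can later be replaced by
    \<open>s * b i\<close>.\<close>
  have Xmono: "X T \<le> X (T - {i})" if "i \<in> T" for i
  proof -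
    have "(\<Prod>i\<in>T. x i) = x i * (\<Prod>i\<in>T - {i}. x i)"
      using that Suc.prems(1) by (rule prod.remove[rotated])
    also have "\<dots> \<le> 1 * (\<Prod>i\<in>T - {i}. x i)"
      using x01 that by (intro mult_right_mono prod_nonneg) auto
    finally show ?thesis unfolding X_def using \<open>0 \<le> s\<close> by (intro mult_left_mono) auto
  qed
  \<comment> \<open>The bound conditional on the first ball \<open>c\<close>: zero outside
    \<open>S\<close>, \<open>X (T - {j})\<close> in bin \<open>j\<close>, and \<open>X T\<close>
    elsewhere in \<open>S\<close>. Being linear in indicators, it integrates termwise.\<close>
  define g where "g c = indicator S c * X T + (\<Sum>i\<in>T. indicator (B i) c * (X (T - {i}) - X T))" for c
  have pointwise: "measure_pmf.prob (replicate_pmf m p) {cs. c # cs \<in> E T} \<le> g c" for c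
  proof (cases "c \<in> S")
    case False
    then have "{cs. c # cs \<in> E T} = {}" by (auto simp: E_def)
    moreover have "g c = 0"
      
    proof -
      have "c \<notin> B i" if "i \<in> T" for i using False Suc.prems(3)[OF that] by blast
      with False show ?thesis unfolding g_def by (auto intro!: sum.neutral)
    qed
    ultimately show ?thesis by simp
  next
    case True
    show ?thesis
    proof (cases "\<exists>j\<in>T. c \<in> B j")
      case False
      then have "{cs. c # cs \<in> E T} = E T" using True by (auto simp: E_def)
      moreover have "g c = X T" unfolding g_def using False True by (auto intro!: sum.neutral)
      ultimately show ?thesis using IH[of T] by simp
    next
      case J: True
      then obtain j where j: "j \<in> T" "c \<in> B j" by blast
      have other: "c \<notin> B i" if "i \<in> T" "i \<noteq> j" for i
        using j that Suc.prems(2) by (auto simp: disjoint_family_on_def)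
      have "{cs. c # cs \<in> E T} = E (T - {j})" using True j other by (auto simp: E_def)
      moreover have "(\<Sum>i\<in>T. indicator (B i) c * (X (T - {i}) - X T)) = X (T - {j}) - X T"
        using j other Suc.prems(1) by (subst sum.remove[of T j]) (auto intro!: sum.neutral)
      then have "g c = X (T - {j})" unfolding g_def using True by simp
      ultimately show ?thesis using IH[of "T - {j}"] by simp
    qed
  qed
  have intg: "integrable (measure_pmf p) g"
    unfolding g_def by (intro Bochner_Integration.integrable_add Bochner_Integration.integrable_sum
        integrable_mult_left integrable_indicator_pmf)
  have "measure_pmf.prob (replicate_pmf (Suc m) p) (E T) \<le> (\<integral>c. g c \<partial>measure_pmf p)"
    unfolding prob_replicate_pmf_Suc
    by (rule integral_mono) (use intg pointwise in auto)
  also have "\<dots> = measure_pmf.prob p S * X T + (\<Sum>i\<in>T. measure_pmf.prob p (B i) * (X (T - {i}) - X T))"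
    unfolding g_def
    by (subst Bochner_Integration.integral_add Bochner_Integration.integral_sum;
        (intro Bochner_Integration.integrable_sum integrable_mult_left integrable_indicator_pmf)?)+ simp
  also have "\<dots> \<le> s * X T + (\<Sum>i\<in>T. s * b i * (X (T - {i}) - X T))"
    using assms(4,5) Suc.prems Xmono x01
    by (intro add_mono sum_mono mult_right_mono) (auto simp: X_def intro!: mult_nonneg_nonneg prod_nonneg)
  also have "(\<Sum>i\<in>T. s * b i * (X (T - {i}) - X T))
      = s ^ Suc m * (\<Sum>i\<in>T. b i * (1 - x i) * (\<Prod>j\<in>T - {i}. x j))"
    unfolding sum_distrib_left
  proof (rule sum.cong)
    fix i assume i: "i \<in> T"
    have "(\<Prod>i\<in>T. x i) = x i * (\<Prod>i\<in>T - {i}. x i)"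
      using i Suc.prems(1) by (rule prod.remove[rotated])
    then show "s * b i * (X (T - {i}) - X T) = s ^ Suc m * (b i * (1 - x i) * (\<Prod>j\<in>T - {i}. x j))"
      by (simp add: X_def algebra_simps)
  qed simp
  also have "s * X T + \<dots> = s ^ Suc m * ((\<Prod>i\<in>T. x i) + (\<Sum>i\<in>T. b i * (1 - x i) * (\<Prod>j\<in>T - {i}. x j)))"
    by (simp add: X_def algebra_simps)
  \<comment> \<open>The first-order terms are completed to a product. Its factor
    \<open>x i + b i * (1 - x i)\<close> reads: hit by the later balls, or else by the first; it
    equals \<open>1 - (1 - b i) ^ Suc m\<close>.\<close>
  also have "\<dots> \<le> s ^ Suc m * (\<Prod>i\<in>T. x i + b i * (1 - x i))"
    using assms(4) Suc.prems x01 by (intro mult_left_mono prod_add_first_order_le) auto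
  also have "(\<Prod>i\<in>T. x i + b i * (1 - x i)) = (\<Prod>i\<in>T. 1 - (1 - b i) ^ Suc m)"
    by (intro prod.cong) (auto simp: x_def algebra_simps)
  finally show ?case by (simp add: E_def)
qed

section \<open>Truth of a clause under random signs\<close>

definition clause_true :: "(nat \<Rightarrow> bool) \<Rightarrow> clause \<Rightarrow> bool" where
  "clause_true \<alpha> c \<longleftrightarrow> (\<exists>(v, s)\<in>set c. \<alpha> v = s)"

lemma satisfies_iff: "satisfies \<alpha> \<Phi> \<longleftrightarrow> (\<forall>c\<in>set \<Phi>. clause_true \<alpha> c)"
  by (simp add: satisfies_def clause_true_def)

text \<open>Once the variables are drawn, exactly one choice of signs falsifies the clause, namely
  the one opposite to the assignment. The bounds for truth and for blocking both rest on
  this.\<close>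

lemma clause_true_zip:
  assumes "length ss = length vs"
  shows "clause_true \<alpha> (zip vs ss) \<longleftrightarrow> ss \<noteq> map (\<lambda>v. \<not> \<alpha> v) vs"
  using assms
proof (induction vs arbitrary: ss)
  case Nil
  then show ?case by (simp add: clause_true_def)
next
  case (Cons v vs)
  then obtain s ss' where "ss = s # ss'" by (cases ss) auto
  with Cons.IH[of ss'] Cons.prems show ?case by (auto simp: clause_true_def)
qed

lemma clause_true_cong:
  assumes "\<And>v. v \<in> fst ` set c \<Longrightarrow> \<alpha> v = \<alpha>' v"
  shows "clause_true \<alpha> c \<longleftrightarrow> clause_true \<alpha>' c"
  using assms unfolding clause_true_def by (intro bex_cong) force+

lemma prob_replicate_fair_coin_singleton:
  assumes "length ss = k"
  shows "measure_pmf.prob (replicate_pmf k (bernoulli_pmf (1/2))) {ss} = 1 / 2 ^ k"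
  using assms
proof (induction k arbitrary: ss)
  case (Suc k)
  then obtain s ss' where ss: "ss = s # ss'" "length ss' = k" by (cases ss) auto
  have "measure_pmf.prob (replicate_pmf k (bernoulli_pmf (1/2))) {cs. c # cs \<in> {ss}}
      = 1 / 2 ^ k * indicator {s} c" for c
    using Suc.IH[OF ss(2)] by (cases "c = s") (simp_all add: ss)
  then show ?case
    unfolding prob_replicate_pmf_Suc by (cases s) (simp_all add: measure_pmf_single)
qed simp

text \<open>Only lists of length \<open>k\<close> carry mass, so at most one outcome in
  \<open>A\<close> counts, and none if \<open>ss'\<close> has another length.\<close>

lemma prob_replicate_fair_coin_le:
  assumes "\<And>ss. length ss = k \<Longrightarrow> ss \<in> A \<Longrightarrow> ss = ss'"
  shows "measure_pmf.prob (replicate_pmf k (bernoulli_pmf (1/2))) A \<le> 1 / 2 ^ k"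
proof -
  let ?M = "replicate_pmf k (bernoulli_pmf (1/2 :: real))"
  have len: "length ss = k" if "ss \<in> set_pmf ?M" for ss
    using that by (auto simp: set_replicate_pmf)
  show ?thesis
  proof (cases "length ss' = k")
    case True
    have "measure_pmf.prob ?M A \<le> measure_pmf.prob ?M {ss'}"
      using assms len by (intro measure_pmf.finite_measure_mono_AE) (auto simp: AE_measure_pmf_iff)
    then show ?thesis by (simp only: prob_replicate_fair_coin_singleton[OF True])
  next
    case False
    then have "measure_pmf.prob ?M A \<le> measure_pmf.prob ?M {}"
      using assms len by (intro measure_pmf.finite_measure_mono_AE) (auto simp: AE_measure_pmf_iff)
    then show ?thesis by (rule order_trans) simp
  qed
qed

lemma prob_clause_pmf:
  "measure_pmf.prob (clause_pmf k p) A =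
   (\<integral>vs. measure_pmf.prob (replicate_pmf k (bernoulli_pmf (1/2))) {ss. zip vs ss \<in> A} \<partial>vars_pmf k p)"
proof -
  have "clause_pmf k p =
      bind_pmf (vars_pmf k p) (\<lambda>vs. map_pmf (zip vs) (replicate_pmf k (bernoulli_pmf (1/2))))"
    by (simp add: clause_pmf_def map_pmf_def)
  then show ?thesis
    by (simp only: prob_bind_pmf measure_map_pmf vimage_def)
qed

section \<open>Repetitions among the drawn variables\<close>

lemma measure_cond_pmf:
  assumes "set_pmf p \<inter> s \<noteq> {}"
  shows "measure_pmf.prob (cond_pmf p s) A = measure_pmf.prob p (s \<inter> A) / measure_pmf.prob p s"
  unfolding cond_pmf.rep_eq[OF assms]
  by (rule measure_uniform_measure) (simp_all add: emeasure_measure_pmf_not_zero[OF assms])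

text \<open>Union bound over the \<open>k\<close> positions.\<close>

lemma prob_mem_replicate_le:
  "measure_pmf.prob (replicate_pmf k p) {vs. i \<in> set vs} \<le> real k * pmf p i"
proof (induction k)
  case (Suc k)
  let ?M = "replicate_pmf k p"
  have "measure_pmf.prob ?M {vs. i \<in> set (v # vs)}
     \<le> indicator {i} v + measure_pmf.prob ?M {vs. i \<in> set vs}" for v
    by (cases "v = i") (auto simp: indicator_def)
  then have "measure_pmf.prob (replicate_pmf (Suc k) p) {vs. i \<in> set vs}
     \<le> (\<integral>v. indicator {i} v + measure_pmf.prob ?M {vs. i \<in> set vs} \<partial>measure_pmf p)"
    unfolding prob_replicate_pmf_Suc by (intro integral_mono) (auto intro!: integrable_indicator_pmf)
  also have "\<dots> = pmf p i + measure_pmf.prob ?M {vs. i \<in> set vs}"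
    by (subst Bochner_Integration.integral_add) (auto intro!: integrable_indicator_pmf simp: measure_pmf_single)
  finally show ?case using Suc by (simp add: algebra_simps)
qed simp

text \<open>Birthday estimate with a crude constant: a variable put in front of \<open>k\<close>
  others repeats one of them with probability at most \<open>k * q\<close>, and
  \<open>k + k\<^sup>2 \<le> (k + 1)\<^sup>2\<close>.\<close>

lemma prob_replicate_not_distinct_le:
  assumes "\<And>i. pmf p i \<le> q"
  shows "measure_pmf.prob (replicate_pmf k p) {vs. \<not> distinct vs} \<le> (real k)\<^sup>2 * q"
proof (induction k)
  case (Suc k)
  let ?M = "replicate_pmf k p"
  have q: "0 \<le> q" using assms[of undefined] pmf_nonneg[of p undefined] by linarith
  have "measure_pmf.prob ?M {vs. \<not> distinct (v # vs)} \<le> real k * q + (real k)\<^sup>2 * q" for v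
  proof -
    have "measure_pmf.prob ?M {vs. \<not> distinct (v # vs)}
      \<le> measure_pmf.prob ?M ({vs. v \<in> set vs} \<union> {vs. \<not> distinct vs})"
      by (intro measure_pmf.finite_measure_mono) auto
    also have "\<dots> \<le> measure_pmf.prob ?M {vs. v \<in> set vs} + measure_pmf.prob ?M {vs. \<not> distinct vs}"
      by (intro measure_Un_le) auto
    also have "measure_pmf.prob ?M {vs. v \<in> set vs} \<le> real k * q"
      using prob_mem_replicate_le[of k p v] mult_left_mono[OF assms[of v], of "real k"] by linarith
    finally show ?thesis using Suc by simp
  qed
  then have "measure_pmf.prob (replicate_pmf (Suc k) p) {vs. \<not> distinct vs}
     \<le> (\<integral>v. real k * q + (real k)\<^sup>2 * q \<partial>measure_pmf p)"
    unfolding prob_replicate_pmf_Suc by (intro integral_mono) auto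
  also have "\<dots> \<le> (real (Suc k))\<^sup>2 * q"
    using q by (simp add: power2_eq_square algebra_simps)
  finally show ?case .
qed simp

section \<open>Truth and blocking probabilities of a random clause\<close>

context
  fixes k :: nat and p :: "nat pmf"
  assumes distinct_possible: "set_pmf (replicate_pmf k p) \<inter> {vs. distinct vs} \<noteq> {}"
begin

text \<open>Intersecting with distinctness shrinks the event, and conditioning divides by the
  probability of distinctness; the rest is the union bound.\<close>

lemma prob_mem_vars_pmf_le:
  "measure_pmf.prob (vars_pmf k p) {vs. i \<in> set vs}
     \<le> real k * pmf p i / measure_pmf.prob (replicate_pmf k p) {vs. distinct vs}"
proof -
  let ?M = "replicate_pmf k p"
  have "measure_pmf.prob ?M ({vs. distinct vs} \<inter> {vs. i \<in> set vs}) \<le> measure_pmf.prob ?M {vs. i \<in> set vs}"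
    by (intro measure_pmf.finite_measure_mono) auto
  also have "\<dots> \<le> real k * pmf p i" by (rule prob_mem_replicate_le)
  finally show ?thesis
    unfolding vars_pmf_def measure_cond_pmf[OF distinct_possible]
    by (intro divide_right_mono) auto
qed

lemma set_vars_pmf: "vs \<in> set_pmf (vars_pmf k p) \<Longrightarrow> length vs = k \<and> set vs \<subseteq> set_pmf p"
  unfolding vars_pmf_def set_cond_pmf[OF distinct_possible] set_replicate_pmf by auto

lemma vars_of_clause_pmf:
  assumes "c \<in> set_pmf (clause_pmf k p)"
  shows "fst ` set c \<subseteq> set_pmf p"
  using assms set_vars_pmf unfolding clause_pmf_def
  by (fastforce dest: set_zip_leftD)

text \<open>For every choice of variables one of the \<open>2 ^ k\<close> sign vectors falsifies the
  clause, so the bound survives averaging over the variables.\<close>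

lemma prob_clause_true_le:
  "measure_pmf.prob (clause_pmf k p) {c. clause_true \<alpha> c} \<le> 1 - 1 / 2 ^ k"
proof -
  let ?M = "replicate_pmf k (bernoulli_pmf (1/2 :: real))"
  have "measure_pmf.prob ?M {ss. clause_true \<alpha> (zip vs ss)} \<le> 1 - 1 / 2 ^ k" if "length vs = k" for vs
  proof -
    have "measure_pmf.prob ?M {ss. clause_true \<alpha> (zip vs ss)}
       \<le> measure_pmf.prob ?M (UNIV - {map (\<lambda>v. \<not> \<alpha> v) vs})"
      using that by (intro measure_pmf.finite_measure_mono) (auto simp: clause_true_zip)
    also have "\<dots> = 1 - 1 / 2 ^ k"
      using that prob_replicate_fair_coin_singleton[of "map (\<lambda>v. \<not> \<alpha> v) vs" k]
      by (subst measure_pmf.prob_compl[where M = ?M, simplified]) auto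
    finally show ?thesis .
  qed
  then have "measure_pmf.prob (clause_pmf k p) {c. clause_true \<alpha> c}
     \<le> (\<integral>vs. 1 - 1 / 2 ^ k \<partial>vars_pmf k p)"
    unfolding prob_clause_pmf using set_vars_pmf
    by (intro integral_mono_AE) (auto simp: AE_measure_pmf_iff)
  then show ?thesis by simp
qed

text \<open>A clause without \<open>i\<close> does not notice the change from
  \<open>\<alpha>\<close> to \<open>\<alpha>'\<close>. In a clause containing \<open>i\<close>,
  falsity under \<open>\<alpha>'\<close> determines all the signs.\<close>

lemma prob_clause_blocks_flip_le:
  assumes "\<And>v. v \<noteq> i \<Longrightarrow> \<alpha> v = \<alpha>' v"
  shows "measure_pmf.prob (clause_pmf k p) {c. clause_true \<alpha> c \<and> \<not> clause_true \<alpha>' c}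
     \<le> 1 / 2 ^ k * measure_pmf.prob (vars_pmf k p) {vs. i \<in> set vs}"
proof -
  let ?M = "replicate_pmf k (bernoulli_pmf (1/2 :: real))"
  let ?A = "{c. clause_true \<alpha> c \<and> \<not> clause_true \<alpha>' c}"
  have "measure_pmf.prob ?M {ss. zip vs ss \<in> ?A} \<le> 1 / 2 ^ k * indicator {vs. i \<in> set vs} vs"
    if "length vs = k" for vs
  proof (cases "i \<in> set vs")
    case True
    have "measure_pmf.prob ?M {ss. zip vs ss \<in> ?A} \<le> 1 / 2 ^ k"
      using that by (intro prob_replicate_fair_coin_le[of _ _ "map (\<lambda>v. \<not> \<alpha>' v) vs"]) (auto simp: clause_true_zip)
    with True show ?thesis by simp
  next
    case False
    have "clause_true \<alpha> (zip vs ss) \<longleftrightarrow> clause_true \<alpha>' (zip vs ss)" for ss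
      using False assms by (intro clause_true_cong) (force dest: set_zip_leftD)
    then show ?thesis by simp
  qed
  then have "measure_pmf.prob (clause_pmf k p) ?A
     \<le> (\<integral>vs. 1 / 2 ^ k * indicator {vs. i \<in> set vs} vs \<partial>vars_pmf k p)"
    unfolding prob_clause_pmf using set_vars_pmf
    by (intro integral_mono_AE integrable_prob integrable_mult_right integrable_indicator_pmf) (auto simp: AE_measure_pmf_iff)
  then show ?thesis by simp
qed


section \<open>First moment over locally maximal solutions\<close>

text \<open>The quantity below \<open>b i\<close> is the blocking bound, \<open>1 / 2 ^ k\<close>
  times the occurrence estimate, divided by \<open>1 - 1 / 2 ^ k\<close>, as for a clause
  conditioned on being true. Leaving \<open>b\<close> free permits a closed form for the power
  law.\<close>

lemma prob_satisfiable_le: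
  assumes "finite (set_pmf p)" and "k \<ge> 1"
    and b: "\<And>i. i \<in> set_pmf p \<Longrightarrow> real k * pmf p i /
      measure_pmf.prob (replicate_pmf k p) {vs. distinct vs} / (2 ^ k - 1) \<le> b i"
    and b1: "\<And>i. i \<in> set_pmf p \<Longrightarrow> b i \<le> 1"
  shows "measure_pmf.prob (replicate_pmf m (clause_pmf k p)) {\<Phi>. satisfiable \<Phi>}
    \<le> (1 - 1 / 2 ^ k) ^ m * (\<Prod>i\<in>set_pmf p. 2 - (1 - b i) ^ m)"
proof -
  let ?V = "set_pmf p" and ?M = "replicate_pmf m (clause_pmf k p)" and ?s = "1 - 1 / 2 ^ k :: real"
  let ?d = "measure_pmf.prob (replicate_pmf k p) {vs. distinct vs}"
  \<comment> \<open>\<open>T\<close> is the set of false variables, so setting \<open>i\<close> to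
    true means removing it from \<open>T\<close>; variables outside \<open>T\<close> are true by
    default.\<close>
  define \<alpha> where "\<alpha> T v \<longleftrightarrow> v \<notin> T" for T :: "nat set" and v
  define B where "B T i = {c. clause_true (\<alpha> T) c \<and> \<not> clause_true (\<alpha> (T - {i})) c}" for T i
  define E where "E T = {\<Phi>. set \<Phi> \<subseteq> {c. clause_true (\<alpha> T) c} \<and> (\<forall>i\<in>T. set \<Phi> \<inter> B T i \<noteq> {})}" for T
  have s0: "0 \<le> ?s" by simp
  have k2: "(2::real) ^ k - 1 > 0" using \<open>k \<ge> 1\<close> by simp
  \<comment> \<open>A clause blocked by \<open>i\<close> is kept true by literals of
    \<open>i\<close> alone, hence it cannot block a second variable.\<close>
  have B_only: "v = i" if "c \<in> B T i" "(v, s) \<in> set c" "\<alpha> T v = s" for T i c v s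
    using that unfolding B_def clause_true_def \<alpha>_def by force
  have disj: "disjoint_family_on (B T) T" for T
    unfolding disjoint_family_on_def
  proof (intro ballI impI Int_emptyI)
    fix i j c assume ij: "i \<noteq> j" "c \<in> B T i" "c \<in> B T j"
    then obtain v s where "(v, s) \<in> set c" "\<alpha> T v = s" by (auto simp: B_def clause_true_def)
    with B_only[OF ij(2)] B_only[OF ij(3)] ij(1) show False by blast
  qed
  have b0: "0 \<le> b i" if "i \<in> ?V" for i
    using k2 by (intro order_trans[OF _ b[OF that]] divide_nonneg_nonneg mult_nonneg_nonneg) auto
  have PB: "measure_pmf.prob (clause_pmf k p) (B T i) \<le> ?s * b i" if "i \<in> ?V" for T i
  proof -
    have "measure_pmf.prob (clause_pmf k p) (B T i)
        \<le> 1 / 2 ^ k * measure_pmf.prob (vars_pmf k p) {vs. i \<in> set vs}"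
      unfolding B_def by (rule prob_clause_blocks_flip_le) (auto simp: \<alpha>_def)
    also have "\<dots> \<le> 1 / 2 ^ k * (real k * pmf p i / ?d)"
      by (intro mult_left_mono prob_mem_vars_pmf_le) auto
    also have "\<dots> = ?s * (real k * pmf p i / ?d / (2 ^ k - 1))"
      using k2 by (cases "?d = 0") (simp_all add: field_simps)
    also have "\<dots> \<le> ?s * b i"
      using b[OF that] s0 by (rule mult_left_mono)
    finally show ?thesis .
  qed
  have PE: "measure_pmf.prob ?M (E T) \<le> ?s ^ m * (\<Prod>i\<in>T. 1 - (1 - b i) ^ m)" if "T \<subseteq> ?V" for T
    unfolding E_def
  proof (rule prob_all_bins_hit_le)
    show "B T i \<subseteq> {c. clause_true (\<alpha> T) c}" for i by (auto simp: B_def)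
  qed (use that assms(1) disj b0 b1 s0 PB prob_clause_true_le in \<open>auto intro: finite_subset\<close>)
  have cover: "\<Phi> \<in> (\<Union>T\<in>Pow ?V. E T)" if \<Phi>: "\<Phi> \<in> set_pmf ?M" and sat: "satisfiable \<Phi>" for \<Phi>
  proof -
    define Q where "Q T \<longleftrightarrow> T \<subseteq> ?V \<and> satisfies (\<alpha> T) \<Phi>" for T
    obtain \<alpha>' where \<alpha>': "satisfies \<alpha>' \<Phi>" using sat by (auto simp: satisfiable_def)
    have vars: "fst ` set c \<subseteq> ?V" if "c \<in> set \<Phi>" for c
      using \<Phi> that vars_of_clause_pmf unfolding set_replicate_pmf by blast
    \<comment> \<open>Variables outside \<open>?V\<close> do not occur in \<open>\<Phi>\<close>, so
      resetting them to true is harmless and yields a candidate inside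
      \<open>Pow ?V\<close>.\<close>
    have "Q {v\<in>?V. \<not> \<alpha>' v}"
      unfolding Q_def satisfies_iff
    proof (intro conjI ballI)
      fix c assume c: "c \<in> set \<Phi>"
      have "clause_true (\<alpha> {v\<in>?V. \<not> \<alpha>' v}) c \<longleftrightarrow> clause_true \<alpha>' c"
        using vars[OF c] by (intro clause_true_cong) (auto simp: \<alpha>_def)
      with c \<alpha>' show "clause_true (\<alpha> {v\<in>?V. \<not> \<alpha>' v}) c" by (simp add: satisfies_iff)
    qed auto
    then obtain T where T: "Q T" and least: "\<And>U. Q U \<Longrightarrow> card T \<le> card U"
      using ex_has_least_nat[of Q _ card] by blast
    \<comment> \<open>If no clause blocked \<open>i\<close>, then \<open>T - {i}\<close> would be a
      smaller candidate.\<close>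
    have "set \<Phi> \<inter> B T i \<noteq> {}" if "i \<in> T" for i
    proof -
      have "finite T" using T assms(1) by (auto simp: Q_def intro: finite_subset)
      then have "card (T - {i}) < card T" using that by (rule card_Diff1_less)
      then have "\<not> Q (T - {i})" using least by fastforce
      then have "\<not> satisfies (\<alpha> (T - {i})) \<Phi>" using T by (auto simp: Q_def)
      then show ?thesis using T by (auto simp: Q_def satisfies_iff B_def)
    qed
    then have "\<Phi> \<in> E T" using T by (auto simp: E_def Q_def satisfies_iff)
    with T show ?thesis by (auto simp: Q_def)
  qed
  have "measure_pmf.prob ?M {\<Phi>. satisfiable \<Phi>} \<le> measure_pmf.prob ?M (\<Union>T\<in>Pow ?V. E T)"
    using cover by (intro measure_pmf.finite_measure_mono_AE) (auto simp: AE_measure_pmf_iff)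
  also have "\<dots> \<le> (\<Sum>T\<in>Pow ?V. measure_pmf.prob ?M (E T))"
    using assms(1) by (intro measure_UNION_le) auto
  also have "\<dots> \<le> (\<Sum>T\<in>Pow ?V. ?s ^ m * (\<Prod>i\<in>T. 1 - (1 - b i) ^ m))"
    using PE by (intro sum_mono) auto
  \<comment> \<open>The sum over all subsets is the expansion of a product whose factors each gain a
    summand 1, for the choice that the variable is true.\<close>
  also have "\<dots> = ?s ^ m * (\<Prod>i\<in>?V. (1 - (1 - b i) ^ m) + 1)"
    unfolding prod_add[OF assms(1)] sum_distrib_left by simp
  finally show ?thesis by (simp add: algebra_simps)
qed

end

section \<open>Power law weights and probabilities\<close>

text \<open>The left side is the integral of the decreasing function
  \<open>z powr (- \<gamma>)\<close> over an interval of length 1 starting at \<open>x\<close>; the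
  mean value theorem replaces the integral.\<close>

lemma powr_neg_ge_diff:
  fixes x \<gamma> :: real
  assumes "0 < x" "0 < \<gamma>" "\<gamma> < 1"
  shows "((x + 1) powr (1 - \<gamma>) - x powr (1 - \<gamma>)) / (1 - \<gamma>) \<le> x powr (- \<gamma>)"
proof -
  have "\<exists>z. x < z \<and> z < x + 1 \<and>
      (x + 1) powr (1 - \<gamma>) - x powr (1 - \<gamma>) = (x + 1 - x) * ((1 - \<gamma>) * z powr (- \<gamma>))"
  proof (rule MVT2)
    fix z assume "x \<le> z"
    then have "((\<lambda>z. z powr (1 - \<gamma>)) has_real_derivative (1 - \<gamma>) * z powr (1 - \<gamma> - 1)) (at z)"
      using assms by (intro has_real_derivative_powr) auto
    then show "((\<lambda>z. z powr (1 - \<gamma>)) has_real_derivative (1 - \<gamma>) * z powr (- \<gamma>)) (at z)" by simp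
  qed simp
  then obtain z where "x < z"
    and "(x + 1) powr (1 - \<gamma>) - x powr (1 - \<gamma>) = (1 - \<gamma>) * z powr (- \<gamma>)" by auto
  moreover have "z powr (- \<gamma>) \<le> x powr (- \<gamma>)"
    using \<open>x < z\<close> assms by (intro powr_mono2') auto
  ultimately show ?thesis using assms by simp
qed

text \<open>Integral comparison, by telescoping the previous bound.\<close>

lemma sum_powr_neg_ge:
  fixes \<gamma> :: real
  assumes "0 < \<gamma>" "\<gamma> < 1"
  shows "((real n + 1) powr (1 - \<gamma>) - 1) / (1 - \<gamma>) \<le> (\<Sum>i=1..n. real i powr (- \<gamma>))"
proof (induction n)
  case (Suc n)
  have "((real n + 1 + 1) powr (1 - \<gamma>) - (real n + 1) powr (1 - \<gamma>)) / (1 - \<gamma>) \<le> (real n + 1) powr (- \<gamma>)"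
    by (rule powr_neg_ge_diff) (use assms in auto)
  with Suc show ?case
    by (simp add: diff_divide_distrib algebra_simps)
qed simp

text \<open>Clauses are sampled by index and estimated by rank; rank 1 belongs to the heaviest
  variable, which has index \<open>n\<close>.\<close>

lemma bij_betw_rank: "bij_betw (\<lambda>j. n + 1 - j) {1..n} {1..n :: nat}"
  by (rule bij_betw_byWitness[where f' = "\<lambda>j. n + 1 - j"]) auto

text \<open>From \<open>exp (b / (1 - b)) \<ge> 1 + b / (1 - b) = 1 / (1 - b)\<close> by taking
  reciprocals. The common bound \<open>z\<close> makes the correction the same for all
  variables.\<close>

lemma one_minus_power_ge_exp:
  fixes b z :: real
  assumes "0 \<le> b" "b \<le> z" "z < 1"
  shows "exp (- (real m * b / (1 - z))) \<le> (1 - b) ^ m"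
proof -
  have "exp (- (b / (1 - z))) \<le> exp (- (b / (1 - b)))"
    using assms by (simp add: frac_le)
  also have "\<dots> \<le> 1 - b"
    using exp_ge_add_one_self[of "b / (1 - b)"] assms by (simp add: exp_minus field_simps)
  finally have "exp (- (b / (1 - z))) ^ m \<le> (1 - b) ^ m" by (rule power_mono) simp
  then show ?thesis by (simp add: exp_of_nat_mult[symmetric])
qed

context
  fixes \<beta> \<gamma> :: real
  assumes beta: "\<beta> > 2" and gamma: "\<gamma> = 1 / (\<beta> - 1)"
begin

lemma gamma_bounds: "0 < \<gamma>" "\<gamma> < 1"
  using beta by (auto simp: gamma)

lemma sum_power_law_weight:
  "(\<Sum>j=1..n. power_law_weight \<beta> n j) = (\<Sum>i=1..n. (real n / real i) powr \<gamma>)"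
  unfolding power_law_weight_def gamma by (rule sum.reindex_bij_betw[OF bij_betw_rank])

text \<open>The crude bound holds because every weight is at least 1, and it suffices to control the
  largest probability. The second bound is sharp to leading order and produces the factor
  \<open>1 - \<gamma> = (\<beta> - 2) / (\<beta> - 1)\<close>.\<close>

lemma sum_power_law_weight_ge:
  assumes "n \<ge> 1"
  shows "real n \<le> (\<Sum>j=1..n. power_law_weight \<beta> n j)"
    and "real n * (1 - real n powr (\<gamma> - 1)) / (1 - \<gamma>) \<le> (\<Sum>j=1..n. power_law_weight \<beta> n j)"
proof -
  have "(\<Sum>i=1..n. 1) \<le> (\<Sum>i=1..n. (real n / real i) powr \<gamma>)"
    using gamma_bounds by (intro sum_mono ge_one_powr_ge_zero) auto
  then show "real n \<le> (\<Sum>j=1..n. power_law_weight \<beta> n j)"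
    unfolding sum_power_law_weight by simp
  have "real n * (1 - real n powr (\<gamma> - 1)) = real n powr \<gamma> * (real n powr (1 - \<gamma>) - 1)"
    using assms by (simp add: powr_diff field_simps)
  also have "\<dots> / (1 - \<gamma>) = real n powr \<gamma> * ((real n powr (1 - \<gamma>) - 1) / (1 - \<gamma>))" by simp
  also have "\<dots> \<le> real n powr \<gamma> * (((real n + 1) powr (1 - \<gamma>) - 1) / (1 - \<gamma>))"
    using gamma_bounds by (intro mult_left_mono divide_right_mono diff_right_mono powr_mono2) auto
  also have "\<dots> \<le> real n powr \<gamma> * (\<Sum>i=1..n. real i powr (- \<gamma>))"
    using gamma_bounds by (intro mult_left_mono sum_powr_neg_ge) auto
  also have "\<dots> = (\<Sum>i=1..n. (real n / real i) powr \<gamma>)"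
    unfolding sum_distrib_left by (intro sum.cong) (auto simp: powr_divide powr_minus_divide)
  finally show "real n * (1 - real n powr (\<gamma> - 1)) / (1 - \<gamma>) \<le> (\<Sum>j=1..n. power_law_weight \<beta> n j)"
    unfolding sum_power_law_weight .
qed

lemma pmf_power_law:
  assumes "n \<ge> 1"
  shows "pmf (var_pmf n (power_law_weight \<beta> n)) j =
    (if j \<in> {1..n} then power_law_weight \<beta> n j / (\<Sum>j=1..n. power_law_weight \<beta> n j) else 0)"
  using assms power_law_weight_pos by (rule pmf_var_pmf)

text \<open>No weight exceeds \<open>n powr \<gamma>\<close> and the total is at least
  \<open>n\<close>. The bound tends to 0, so repetitions and large blocking probabilities disappear
  in the limit.\<close>

lemma pmf_power_law_le:
  assumes "n \<ge> 1"
  shows "pmf (var_pmf n (power_law_weight \<beta> n)) j \<le> real n powr (\<gamma> - 1)"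
proof (cases "j \<in> {1..n}")
  case True
  then have "power_law_weight \<beta> n j \<le> real n powr \<gamma>"
    unfolding power_law_weight_def gamma[symmetric] using gamma_bounds
    by (intro powr_mono2) (auto simp: field_simps of_nat_diff)
  then have "power_law_weight \<beta> n j / (\<Sum>j=1..n. power_law_weight \<beta> n j) \<le> real n powr \<gamma> / real n"
    using assms sum_power_law_weight_ge(1)[OF assms] by (intro frac_le) auto
  with True show ?thesis
    using assms by (simp add: pmf_power_law powr_diff)
qed (use assms in \<open>auto simp: pmf_power_law\<close>)

text \<open>The factor \<open>x n\<close> absorbs three errors: in the total weight, from
  conditioning on distinctness, and from passing to the exponential. It depends on \<open>n\<close>
  only, so the bound is uniform in \<open>m\<close>.\<close>

lemma prob_power_law_satisfiable_le:
  fixes k :: nat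
  assumes "k \<ge> 1"
  shows "\<exists>x. x \<longlonglongrightarrow> 1 \<and> (\<forall>\<^sub>F n in sequentially. \<forall>m.
    measure_pmf.prob (ksat_pmf k n m (power_law_weight \<beta> n)) {\<Phi>. satisfiable \<Phi>}
      \<le> (1 - 1 / 2 ^ k) ^ m *
        (\<Prod>i=1..n. 2 - exp (- (x n * (real m / real n) * (real k / (2 ^ k - 1) * (1 - \<gamma>)) * (real n / real i) powr \<gamma>))))"
proof -
  define c where "c = real k / (2 ^ k - 1) * (1 - \<gamma>)"
  \<comment> \<open>\<open>t n\<close> bounds every variable probability, \<open>y n\<close> is
    \<open>c\<close> corrected for total weight and distinctness, and \<open>x n\<close> is
    \<open>y n / c\<close> with the exponential correction \<open>1 - y n * t n\<close> added to the
    denominator.\<close>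
  define t where "t n = real n powr (\<gamma> - 1)" for n :: nat
  define y where "y n = c / ((1 - t n) * (1 - (real k)\<^sup>2 * t n))" for n
  define x where "x n = 1 / ((1 - t n) * (1 - (real k)\<^sup>2 * t n) * (1 - y n * t n))" for n
  have k2: "(2::real) ^ k - 1 > 0" using \<open>k \<ge> 1\<close> by simp
  have c0: "c > 0" unfolding c_def using k2 \<open>k \<ge> 1\<close> gamma_bounds by simp
  have t: "t \<longlonglongrightarrow> 0" unfolding t_def using gamma_bounds(2) by real_asymp
  have y: "y \<longlonglongrightarrow> c / ((1 - 0) * (1 - (real k)\<^sup>2 * 0))"
    unfolding y_def by (intro tendsto_intros t) auto
  have yt: "(\<lambda>n. y n * t n) \<longlonglongrightarrow> 0"
    using tendsto_mult[OF y t] by simp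
  have "x \<longlonglongrightarrow> 1 / ((1 - 0) * (1 - (real k)\<^sup>2 * 0) * (1 - 0))"
    unfolding x_def by (intro tendsto_intros t yt) auto
  then have "x \<longlonglongrightarrow> 1" by simp
  moreover have "\<forall>\<^sub>F n in sequentially. \<forall>m.
    measure_pmf.prob (ksat_pmf k n m (power_law_weight \<beta> n)) {\<Phi>. satisfiable \<Phi>}
      \<le> (1 - 1 / 2 ^ k) ^ m *
        (\<Prod>i=1..n. 2 - exp (- (x n * (real m / real n) * c * (real n / real i) powr \<gamma>)))"
  proof -
    have "(\<lambda>n. (real k)\<^sup>2 * t n) \<longlonglongrightarrow> 0"
      using tendsto_mult[OF tendsto_const t, of "(real k)\<^sup>2"] by simp
    then have ev: "\<forall>\<^sub>F n in sequentially. (real k)\<^sup>2 * t n < 1" "\<forall>\<^sub>F n in sequentially. t n < 1"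
       "\<forall>\<^sub>F n in sequentially. y n * t n < 1"
      using t yt by (auto intro: order_tendstoD)
    show ?thesis
      using ev eventually_ge_at_top[of "max 1 k"]
    proof (eventually_elim, intro allI)
      fix n m :: nat
      assume kt: "(real k)\<^sup>2 * t n < 1" and t1: "t n < 1" and yt1: "y n * t n < 1" and n: "max 1 k \<le> n"
      let ?p = "var_pmf n (power_law_weight \<beta> n)"
      let ?d = "measure_pmf.prob (replicate_pmf k ?p) {vs. distinct vs}"
      let ?W = "\<Sum>j=1..n. power_law_weight \<beta> n j"
      \<comment> \<open>Here \<open>b\<close> is indexed by rank, hence the shift to
        \<open>n + 1 - j\<close> when it is applied to variable \<open>j\<close>.\<close>
      define b where "b i = y n * (real n / real i) powr \<gamma> / real n" for i
      have n1: "n \<ge> 1" using n by simp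
      have t0: "t n \<ge> 0" by (simp add: t_def)
      have set_p: "set_pmf ?p = {1..n}"
        using n1 power_law_weight_pos by (rule set_var_pmf)
      have y0: "y n \<ge> 0" unfolding y_def using c0 kt t1 by simp
      have b0: "0 \<le> b i" for i unfolding b_def using y0 by simp
      have b_le: "b i \<le> y n * t n" if "i \<in> {1..n}" for i
      proof -
        have "(real n / real i) powr \<gamma> \<le> real n powr \<gamma>"
          using that gamma_bounds by (intro powr_mono2) (auto simp: field_simps)
        then have "y n * (real n / real i) powr \<gamma> / real n \<le> y n * real n powr \<gamma> / real n"
          using y0 by (intro divide_right_mono mult_left_mono) auto
        then show ?thesis unfolding b_def t_def using n1 by (simp add: powr_diff)
      qed
      have d: "?d \<ge> 1 - (real k)\<^sup>2 * t n"
      proof -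
        have "measure_pmf.prob (replicate_pmf k ?p) {vs. \<not> distinct vs} \<le> (real k)\<^sup>2 * t n"
          unfolding t_def by (intro prob_replicate_not_distinct_le pmf_power_law_le n1)
        moreover have "measure_pmf.prob (replicate_pmf k ?p) {vs. \<not> distinct vs} = 1 - ?d"
          using measure_pmf.prob_compl[of "{vs. distinct vs}" "replicate_pmf k ?p"]
          by (simp add: Compl_eq_Diff_UNIV[symmetric] Collect_neg_eq)
        ultimately show ?thesis by simp
      qed
      have ranked: "real k * pmf ?p j / ?d / (2 ^ k - 1) \<le> b (n + 1 - j)" if "j \<in> {1..n}" for j
      proof -
        have W: "real n * (1 - t n) / (1 - \<gamma>) \<le> ?W"
          using sum_power_law_weight_ge(2)[OF n1] by (simp add: t_def)
        have pos: "real n * (1 - t n) / (1 - \<gamma>) > 0" using n1 t1 gamma_bounds by simp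
        let ?w = "(real n / real (n + 1 - j)) powr \<gamma>"
        have "real k * pmf ?p j / ?d / (2 ^ k - 1) = real k * ?w / (?W * ?d * (2 ^ k - 1))"
          using that n1 by (simp add: pmf_power_law power_law_weight_def gamma)
        also have "\<dots> \<le> real k * ?w / (real n * (1 - t n) / (1 - \<gamma>) * (1 - (real k)\<^sup>2 * t n) * (2 ^ k - 1))"
          using W pos d kt k2
          by (intro divide_left_mono mult_right_mono mult_mono mult_pos_pos mult_nonneg_nonneg) auto
        also have "\<dots> = b (n + 1 - j)"
          unfolding b_def y_def c_def using gamma_bounds by (simp add: field_simps)
        finally show ?thesis .
      qed
      have "measure_pmf.prob (replicate_pmf m (clause_pmf k ?p)) {\<Phi>. satisfiable \<Phi>}
         \<le> (1 - 1 / 2 ^ k) ^ m * (\<Prod>j\<in>set_pmf ?p. 2 - (1 - b (n + 1 - j)) ^ m)"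
      proof (rule prob_satisfiable_le)
        show "set_pmf (replicate_pmf k ?p) \<inter> {vs. distinct vs} \<noteq> {}"
          using n power_law_weight_pos by (intro vars_pmf_cond_nonempty) auto
        show "b (n + 1 - j) \<le> 1" if "j \<in> set_pmf ?p" for j
          using that bij_betwE[OF bij_betw_rank] b_le yt1 unfolding set_p by fastforce
      qed (use ranked \<open>k \<ge> 1\<close> in \<open>auto simp: set_p\<close>)
      also have "(\<Prod>j\<in>set_pmf ?p. 2 - (1 - b (n + 1 - j)) ^ m) = (\<Prod>i=1..n. 2 - (1 - b i) ^ m)"
        unfolding set_p by (rule prod.reindex_bij_betw[OF bij_betw_rank])
      also have "(1 - 1 / 2 ^ k) ^ m * \<dots> \<le> (1 - 1 / 2 ^ k) ^ m *
          (\<Prod>i=1..n. 2 - exp (- (x n * (real m / real n) * c * (real n / real i) powr \<gamma>)))"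
      proof (intro mult_left_mono prod_mono conjI)
        fix i assume i: "i \<in> {1..n}"
        have "(1 - b i) ^ m \<le> 1" using b0[of i] b_le[OF i] yt1 by (intro power_le_one) auto
        then show "0 \<le> 2 - (1 - b i) ^ m" by simp
        have "exp (- (real m * b i / (1 - y n * t n))) \<le> (1 - b i) ^ m"
          using b0 b_le[OF i] yt1 by (rule one_minus_power_ge_exp)
        also have "real m * b i / (1 - y n * t n) = x n * (real m / real n) * c * (real n / real i) powr \<gamma>"
          by (simp add: b_def x_def y_def mult_ac)
        finally show "2 - (1 - b i) ^ m \<le> 2 - exp (- (x n * (real m / real n) * c * (real n / real i) powr \<gamma>))"
          by simp
      qed simp
      finally show "measure_pmf.prob (ksat_pmf k n m (power_law_weight \<beta> n)) {\<Phi>. satisfiable \<Phi>}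
        \<le> (1 - 1 / 2 ^ k) ^ m *
          (\<Prod>i=1..n. 2 - exp (- (x n * (real m / real n) * c * (real n / real i) powr \<gamma>)))"
        unfolding ksat_pmf_def .
    qed
  qed
  ultimately show ?thesis unfolding c_def by blast
qed

end

section \<open>Cutting the ranks into blocks\<close>

text \<open>By monotonicity of \<open>a\<close> the blocks tile the interval, and within a block all
  factors share one bound.\<close>

lemma prod_blocks_le:
  fixes h D :: "nat \<Rightarrow> real" and a :: "nat \<Rightarrow> nat"
  assumes "mono a" "K \<le> L" "\<And>i. 0 \<le> h i"
    and "\<And>l i. K \<le> l \<Longrightarrow> l < L \<Longrightarrow> i \<in> {a l<..a (Suc l)} \<Longrightarrow> h i \<le> D l"
  shows "(\<Prod>i\<in>{a K<..a L}. h i) \<le> (\<Prod>l=K..<L. D l ^ (a (Suc l) - a l))"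
  using assms(2,4)
proof (induction L rule: dec_induct)
  case (step M)
  have DM: "h i \<le> D M" if "i \<in> {a M<..a (Suc M)}" for i
    using step.hyps(1) that by (intro step.prems) auto
  have "{a K<..a (Suc M)} = {a K<..a M} \<union> {a M<..a (Suc M)}"
    using monoD[OF \<open>mono a\<close>, of K M] monoD[OF \<open>mono a\<close>, of M "Suc M"] step.hyps by auto
  then have "(\<Prod>i\<in>{a K<..a (Suc M)}. h i) = (\<Prod>i\<in>{a K<..a M}. h i) * (\<Prod>i\<in>{a M<..a (Suc M)}. h i)"
    by (simp add: prod.union_disjoint)
  also have "\<dots> \<le> (\<Prod>l=K..<M. D l ^ (a (Suc l) - a l)) * (\<Prod>i\<in>{a M<..a (Suc M)}. D M)"
  proof (rule mult_mono)
    show "(\<Prod>i\<in>{a K<..a M}. h i) \<le> (\<Prod>l=K..<M. D l ^ (a (Suc l) - a l))"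
      using step.prems by (intro step.IH) auto
    \<comment> \<open>The product of the powers of \<open>D l\<close> inherits its sign from the
      smaller product of the \<open>h i\<close>.\<close>
    moreover have "0 \<le> (\<Prod>i\<in>{a K<..a M}. h i)" by (intro prod_nonneg assms(3))
    ultimately show "0 \<le> (\<Prod>l=K..<M. D l ^ (a (Suc l) - a l))" by linarith
    show "(\<Prod>i\<in>{a M<..a (Suc M)}. h i) \<le> (\<Prod>i\<in>{a M<..a (Suc M)}. D M)"
      using DM assms(3) by (intro prod_mono) auto
  qed (intro prod_nonneg assms(3))
  also have "\<dots> = (\<Prod>l=K..<Suc M. D l ^ (a (Suc l) - a l))"
    using step.hyps by simp
  finally show ?case .
qed simp

text \<open>One side of the Lipschitz bound for \<open>exp (- u)\<close> on
  \<open>u \<ge> 0\<close>, from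
  \<open>exp (- u) - exp (- v) = exp (- u) * (1 - exp (u - v))\<close>. It compares the given error
  terms with the one that the first moment produces.\<close>

lemma exp_neg_diff_le:
  fixes u v :: real
  assumes "0 \<le> u" "0 \<le> v"
  shows "exp (- u) - exp (- v) \<le> \<bar>u - v\<bar>"
proof (cases "u \<le> v")
  case True
  have "1 - (v - u) \<le> exp (u - v)" using exp_ge_add_one_self[of "u - v"] by linarith
  moreover have "exp (- v) = exp (- u) * exp (u - v)" by (simp add: exp_add[symmetric])
  ultimately have "exp (- u) - exp (- v) \<le> exp (- u) * (v - u)"
    using mult_left_mono[of "1 - (v - u)" "exp (u - v)" "exp (- u)"] by (simp add: algebra_simps)
  also have "\<dots> \<le> 1 * (v - u)" using True assms by (intro mult_right_mono) auto
  finally show ?thesis using True by simp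
next
  case False
  then have "exp (- u) \<le> exp (- v)" by simp
  then show ?thesis by linarith
qed

lemma real_div_bounds:
  fixes a b :: nat
  assumes "b > 0"
  shows "real (a div b) \<le> real a / real b" "real a / real b - 1 < real (a div b)"
proof -
  have "\<lfloor>real a / real b\<rfloor> = int (a div b)" by (simp add: floor_divide_of_nat_eq)
  then show "real (a div b) \<le> real a / real b" "real a / real b - 1 < real (a div b)"
    by linarith+
qed

text \<open>Block \<open>l \<ge> 1\<close> is matched with factor \<open>l\<close> of the
  hypothesis, and block 0 with \<open>2 powr (1 / N)\<close>. Half of block 0 supplies the gain
  \<open>\<theta>\<close>, which is a constant because \<open>r \<le> R\<close>. The number
  \<open>e\<close> pays for the mismatch of \<open>x\<close> and \<open>1 + \<eta> l\<close>, and
  \<open>2 ^ (N + 1)\<close> for rounding the block ends.\<close>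

lemma first_moment_blocks_le:
  fixes n N :: nat and c \<gamma> r R x e s :: real and \<eta> :: "nat \<Rightarrow> real"
  assumes "N \<ge> 1" "n \<ge> 1" "c > 0" "\<gamma> > 0" "0 \<le> r" "r \<le> R" "0 \<le> x" "x \<le> 2" "0 < s"
    and \<eta>: "\<And>l. l \<in> {1..N-1} \<Longrightarrow> -1 \<le> \<eta> l"
    and e: "0 \<le> e" "\<And>l. l \<in> {1..N-1} \<Longrightarrow> \<bar>x - (1 + \<eta> l)\<bar> * (R * c * real N powr \<gamma>) \<le> e"
    and hyp: "s powr r * 2 powr (1 / real N) *
      (\<Prod>l=1..N-1. (2 - exp (- ((1 + \<eta> l) * r * c * (real N / real l) powr \<gamma>))) powr (1 / real N)) < 1"
  defines "\<theta> \<equiv> 1 - exp (- (2 * R * c * (2 * real N) powr \<gamma>)) / 2"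
  shows "s powr (r * real n) * (\<Prod>i=1..n. 2 - exp (- (x * r * c * (real n / real i) powr \<gamma>)))
    \<le> 2 ^ (N + 1) * ((1 + e) * \<theta> powr (1 / (2 * real N))) powr real n"
proof -
  define h where "h i = 2 - exp (- (x * r * c * (real n / real i) powr \<gamma>))" for i :: nat
  define G where "G l = 2 - exp (- (x * r * c * (real N / real l) powr \<gamma>))" for l :: nat
  define G' where "G' l = 2 - exp (- ((1 + \<eta> l) * r * c * (real N / real l) powr \<gamma>))" for l :: nat
  \<comment> \<open>Block \<open>l\<close> is \<open>{a l<..a (Suc l)}\<close>, with about
    \<open>n / N\<close> ranks; \<open>a'\<close> is the middle of block 0.\<close>
  define a where "a l = (l * n) div N" for l
  define a' where "a' = n div (2 * N)"
  have R0: "0 \<le> R" using assms by linarith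
  have theta: "1 / 2 \<le> \<theta>" "\<theta> < 1"
    unfolding \<theta>_def using R0 \<open>c > 0\<close> by (auto intro!: mult_nonneg_nonneg)
  have N0: "real N > 0" and n0: "real n > 0" using assms by auto
  have h_bounds: "1 \<le> h i" "h i \<le> 2" for i
    unfolding h_def using assms by (auto intro!: mult_nonneg_nonneg)
  have h0: "0 \<le> h i" for i using h_bounds(1)[of i] by linarith
  have G_bounds: "1 \<le> G l" "G l \<le> 2" for l
    unfolding G_def using assms by (auto intro!: mult_nonneg_nonneg)
  have G'_ge: "1 \<le> G' l" if "l \<in> {1..N-1}" for l
    unfolding G'_def using assms \<eta>[OF that] by (auto intro!: mult_nonneg_nonneg)
  have a_bounds: "real (a l) \<le> real l * real n / real N" "real l * real n / real N - 1 < real (a l)" for l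
    using real_div_bounds[of N "l * n"] N0 by (auto simp: a_def)
  have a'_bounds: "real a' \<le> real n / (2 * real N)" "real n / (2 * real N) - 1 < real a'"
    using real_div_bounds[of "2 * N" n] N0 by (auto simp: a'_def)
  have mono_a: "mono a"
    unfolding a_def by (intro monoI div_le_mono mult_le_mono1)
  have aN: "a N = n" unfolding a_def using N0 by simp
  have a'_le: "a' \<le> a 1"
    unfolding a_def a'_def using \<open>N \<ge> 1\<close> by (simp add: div_le_mono2)

  \<comment> \<open>Beyond the middle of block 0, \<open>x \<le> 2\<close> and
    \<open>r \<le> R\<close> bound the exponent by the constant in \<open>\<theta>\<close>.\<close>
  have half: "h i \<le> 2 * \<theta>" if "a' < i" for i
  proof -
    have "real a' + 1 \<le> real i" using that by linarith
    then have "real n / (2 * real N) \<le> real i" using a'_bounds by linarith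
    then have "real n / real i \<le> 2 * real N"
      using N0 that by (simp add: field_simps)
    then have "x * r * c * (real n / real i) powr \<gamma> \<le> 2 * R * c * (2 * real N) powr \<gamma>"
      using assms R0 by (intro mult_mono powr_mono2) auto
    then show ?thesis unfolding h_def \<theta>_def by simp
  qed
  \<comment> \<open>As an integer above \<open>a l\<close>, the rank is at least
    \<open>a l + 1\<close>, which undoes the rounding down and gives
    \<open>i \<ge> l * n / N\<close>.\<close>
  have block: "h i \<le> G l" if "1 \<le> l" "i \<in> {a l<..a (Suc l)}" for l i
  proof -
    have "real (a l) + 1 \<le> real i" using that by auto
    then have "real l * real n / real N \<le> real i" using a_bounds[of l] by linarith
    then have "real n / real i \<le> real N / real l"
      using N0 that n0 by (simp add: field_simps)
    then have "x * r * c * (real n / real i) powr \<gamma> \<le> x * r * c * (real N / real l) powr \<gamma>"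
      using assms by (intro mult_left_mono powr_mono2 mult_nonneg_nonneg) auto
    then show ?thesis unfolding h_def G_def by simp
  qed
  have GG': "G l \<le> G' l * (1 + e)" if l: "l \<in> {1..N-1}" for l
  proof -
    let ?g = "(real N / real l) powr \<gamma>"
    have "G l - G' l \<le> \<bar>(1 + \<eta> l) * r * c * ?g - x * r * c * ?g\<bar>"
      unfolding G_def G'_def
      using exp_neg_diff_le[of "(1 + \<eta> l) * r * c * ?g" "x * r * c * ?g"] assms \<eta>[OF l] by simp
    also have "\<dots> = \<bar>((1 + \<eta> l) - x) * (r * c * ?g)\<bar>"
      by (simp add: algebra_simps)
    also have "\<dots> = \<bar>x - (1 + \<eta> l)\<bar> * (r * c * ?g)"
      using assms by (simp add: abs_mult abs_minus_commute)
    also have "\<dots> \<le> \<bar>x - (1 + \<eta> l)\<bar> * (R * c * real N powr \<gamma>)"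
      using assms l R0 by (intro mult_left_mono mult_mono powr_mono2) (auto simp: field_simps)
    also have "\<dots> \<le> e" using e l by auto
    \<comment> \<open>\<open>G' l \<ge> 1\<close> turns the additive error into the factor
      \<open>1 + e\<close>.\<close>
    also have "e \<le> G' l * e" using G'_ge[OF l] e by (simp add: mult_le_cancel_right1)
    finally show ?thesis by (simp add: algebra_simps)
  qed

  have split: "(\<Prod>i=1..n. h i) = (\<Prod>i\<in>{0<..a'}. h i) * (\<Prod>i\<in>{a'<..a 1}. h i) * (\<Prod>i\<in>{a 1<..a N}. h i)"
  proof -
    have "a 1 \<le> n" using monoD[OF mono_a \<open>N \<ge> 1\<close>] aN by simp
    then have "{1..n} = ({0<..a'} \<union> {a'<..a 1}) \<union> {a 1<..a N}"
      using a'_le by (auto simp: aN)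
    then have "(\<Prod>i=1..n. h i) = (\<Prod>i\<in>({0<..a'} \<union> {a'<..a 1}) \<union> {a 1<..a N}. h i)" by simp
    also have "\<dots> = (\<Prod>i\<in>{0<..a'} \<union> {a'<..a 1}. h i) * (\<Prod>i\<in>{a 1<..a N}. h i)"
      using a'_le by (intro prod.union_disjoint) auto
    also have "(\<Prod>i\<in>{0<..a'} \<union> {a'<..a 1}. h i) = (\<Prod>i\<in>{0<..a'}. h i) * (\<Prod>i\<in>{a'<..a 1}. h i)"
      by (intro prod.union_disjoint) auto
    finally show ?thesis .
  qed
  have first: "(\<Prod>i\<in>{0<..a'}. h i) * (\<Prod>i\<in>{a'<..a 1}. h i)
      \<le> 2 powr (real n / real N) * (2 * \<theta> powr (real n / (2 * real N)))"
  proof -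
    have "(\<Prod>i\<in>{0<..a'}. h i) * (\<Prod>i\<in>{a'<..a 1}. h i) \<le> (\<Prod>i\<in>{0<..a'}. 2) * (\<Prod>i\<in>{a'<..a 1}. 2 * \<theta>)"
      using half h_bounds h0 theta by (intro mult_mono prod_mono prod_nonneg) auto
    also have "\<dots> = 2 ^ a 1 * \<theta> ^ (a 1 - a')"
      using a'_le by (simp add: power_mult_distrib power_add[symmetric] mult.assoc[symmetric])
    also have "\<dots> = 2 powr real (a 1) * \<theta> powr real (a 1 - a')"
      using theta by (simp add: powr_realpow)
    \<comment> \<open>After rounding, \<open>\<theta>\<close> applies to at least
      \<open>n / (2 * N) - 1\<close> ranks; the missing one costs
      \<open>1 / \<theta> \<le> 2\<close>.\<close>
    also have "\<dots> \<le> 2 powr (real n / real N) * \<theta> powr (real n / (2 * real N) - 1)"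
    proof (rule mult_mono)
      show "2 powr real (a 1) \<le> 2 powr (real n / real N)"
        using a_bounds[of 1] by (intro powr_mono) auto
      have "real n / (2 * real N) - 1 \<le> real (a 1 - a')"
        using a_bounds[of 1] a'_bounds a'_le N0 by (simp add: of_nat_diff field_simps)
      then show "\<theta> powr real (a 1 - a') \<le> \<theta> powr (real n / (2 * real N) - 1)"
        using theta by (intro powr_mono') auto
    qed auto
    also have "\<theta> powr (real n / (2 * real N) - 1) = \<theta> powr (real n / (2 * real N)) / \<theta>"
      using theta by (simp add: powr_diff)
    also have "\<dots> \<le> \<theta> powr (real n / (2 * real N)) / (1 / 2)"
      using theta by (intro divide_left_mono) auto
    finally show ?thesis by (simp add: mult_ac mult_left_mono)
  qed
  have rest: "(\<Prod>i\<in>{a 1<..a N}. h i)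
      \<le> 2 ^ N * (\<Prod>l=1..N-1. G' l powr (1 / real N)) powr real n * (1 + e) powr real n"
  proof -
    have "(\<Prod>i\<in>{a 1<..a N}. h i) \<le> (\<Prod>l=1..<N. G l ^ (a (Suc l) - a l))"
      using mono_a \<open>N \<ge> 1\<close> h0 block by (intro prod_blocks_le) auto
    also have "\<dots> \<le> (\<Prod>l=1..<N. 2 * (G' l powr (1 / real N)) powr real n * (1 + e) powr (real n / real N))"
    proof (intro prod_mono conjI)
      fix l assume "l \<in> {1..<N}"
      then have l: "l \<in> {1..N-1}" by auto
      show "0 \<le> G l ^ (a (Suc l) - a l)" using G_bounds[of l] by simp
      \<comment> \<open>Rounding adds at most one rank to a block, at the price of one more factor
        \<open>G l \<le> 2\<close>.\<close>
      have "real (a (Suc l) - a l) \<le> real n / real N + 1"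
        using a_bounds(1)[of "Suc l"] a_bounds(2)[of l] monoD[OF mono_a, of l "Suc l"] N0
        by (simp add: of_nat_diff field_simps)
      then have "G l powr real (a (Suc l) - a l) \<le> G l powr (real n / real N + 1)"
        using G_bounds[of l] by (intro powr_mono) auto
      moreover have "G l ^ (a (Suc l) - a l) = G l powr real (a (Suc l) - a l)"
        using G_bounds(1)[of l] by (simp add: powr_realpow)
      moreover have "G l powr (real n / real N + 1) = G l powr (real n / real N) * G l"
        using G_bounds(1)[of l] by (simp add: powr_add)
      moreover have "\<dots> \<le> (G' l * (1 + e)) powr (real n / real N) * 2"
        using GG'[OF l] G_bounds[of l] by (intro mult_mono powr_mono2) auto
      moreover have "(G' l * (1 + e)) powr (real n / real N) * 2
          = 2 * (G' l powr (1 / real N)) powr real n * (1 + e) powr (real n / real N)"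
        using G'_ge[OF l] e(1) by (simp add: powr_mult powr_powr)
      ultimately show "G l ^ (a (Suc l) - a l)
          \<le> 2 * (G' l powr (1 / real N)) powr real n * (1 + e) powr (real n / real N)"
        by linarith
    qed
    also have "\<dots> = 2 ^ (N - 1) * (\<Prod>l=1..N-1. G' l powr (1 / real N)) powr real n
        * (1 + e) powr (real n / real N * real (N - 1))"
    proof -
      have "{1..<N} = {1..N-1}" by auto
      moreover have "(\<Prod>l=1..N-1. (G' l powr (1 / real N)) powr real n)
          = (\<Prod>l=1..N-1. G' l powr (1 / real N)) powr real n"
        by (rule prod_powr_distrib[symmetric])
      moreover have "((1 + e) powr (real n / real N)) ^ (N - 1) = (1 + e) powr (real n / real N * real (N - 1))"
        using e(1) by (subst powr_realpow[symmetric]) (simp_all add: powr_powr)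
      ultimately show ?thesis by (simp add: prod.distrib)
    qed
    also have "\<dots> \<le> 2 ^ N * (\<Prod>l=1..N-1. G' l powr (1 / real N)) powr real n * (1 + e) powr real n"
    proof (intro mult_mono)
      have "real n / real N * real (N - 1) \<le> real n / real N * real N"
        by (intro mult_left_mono) auto
      then show "(1 + e) powr (real n / real N * real (N - 1)) \<le> (1 + e) powr real n"
        using N0 e(1) by (intro powr_mono) auto
    qed auto
    finally show ?thesis .
  qed
  define P where "P = (\<Prod>l=1..N-1. G' l powr (1 / real N))"
  have P0: "0 \<le> P" unfolding P_def by (intro prod_nonneg) simp
  have "s powr (r * real n) * (\<Prod>i=1..n. h i)
     \<le> s powr (r * real n) * ((2 powr (real n / real N) * (2 * \<theta> powr (real n / (2 * real N)))) *
        (2 ^ N * P powr real n * (1 + e) powr real n))"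
    unfolding split P_def
    by (intro mult_left_mono mult_mono[OF first rest] mult_nonneg_nonneg prod_nonneg) (use h0 e in auto)
  \<comment> \<open>The powers regroup into the \<open>n\<close>-th power of the expression assumed
    to be below 1, leaving only gain, error and rounding cost.\<close>
  also have "\<dots> = (s powr r * 2 powr (1 / real N) * P) powr real n *
      (2 ^ (N + 1) * ((1 + e) * \<theta> powr (1 / (2 * real N))) powr real n)"
    using e(1) theta \<open>0 < s\<close> P0 by (simp add: powr_mult powr_powr)
  also have "\<dots> \<le> 1 * (2 ^ (N + 1) * ((1 + e) * \<theta> powr (1 / (2 * real N))) powr real n)"
  proof (intro mult_right_mono)
    have "0 \<le> s powr r * 2 powr (1 / real N) * P" using P0 by simp
    moreover have "s powr r * 2 powr (1 / real N) * P \<le> 1" using hyp by (simp add: G'_def P_def)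
    ultimately show "(s powr r * 2 powr (1 / real N) * P) powr real n \<le> 1"
      using powr_mono2[of "real n" _ 1] by simp
  qed simp
  finally show ?thesis by (simp add: h_def)
qed

section \<open>Exponential decay of the probability of satisfiability\<close>

theorem theorem12:
  fixes k N :: nat and \<beta> :: real and m :: "nat \<Rightarrow> nat" and r :: "nat \<Rightarrow> real"
    and \<epsilon> :: "nat \<Rightarrow> nat \<Rightarrow> real"
  assumes "k \<ge> 2" and "\<beta> > 2" and "N \<ge> 1"
    and "\<And>n. r n = real (m n) / real n"
    and "\<And>l. l \<in> {1..N-1} \<Longrightarrow> \<epsilon> l \<in> o(\<lambda>n. 1)"
    and "\<forall>\<^sub>F n in sequentially.
      (1 - 1 / 2 ^ k) powr (r n) * 2 powr (1 / real N) *
      (\<Prod>l=1..N-1.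
        (2 - exp (- (1 + \<epsilon> l n) * r n * (real k / (2 ^ k - 1)) * ((\<beta> - 2) / (\<beta> - 1)) *
               (real N / real l) powr (1 / (\<beta> - 1)))) powr (1 / real N)) < 1"
  shows "whp (\<lambda>n. measure_pmf.prob (ksat_pmf k n (m n) (power_law_weight \<beta> n))
           {\<Phi>. \<not> satisfiable \<Phi>})"
proof -
  define \<gamma> where "\<gamma> = 1 / (\<beta> - 1)"
  define c where "c = real k / (2 ^ k - 1) * (1 - \<gamma>)"
  define s where "s = (1 - 1 / 2 ^ k :: real)"
  \<comment> \<open>Chosen so that \<open>s powr R = 1 / 4\<close>: beyond \<open>R\<close>, summing
    over all \<open>2 ^ n\<close> assignments already leaves at most
    \<open>(1 / 2) ^ n\<close>.\<close>
  define R where "R = ln (1 / 4) / ln s"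
  define \<theta> where "\<theta> = 1 - exp (- (2 * R * c * (2 * real N) powr \<gamma>)) / 2"
  \<comment> \<open>The gain per variable when \<open>\<theta>\<close> applies to a fraction
    \<open>1 / (2 * N)\<close> of the ranks.\<close>
  define \<theta>' where "\<theta>' = \<theta> powr (1 / (2 * real N))"
  define p where "p n = measure_pmf.prob (ksat_pmf k n (m n) (power_law_weight \<beta> n)) {\<Phi>. satisfiable \<Phi>}" for n
  have gamma: "0 < \<gamma>" "\<gamma> < 1" using \<open>\<beta> > 2\<close> by (rule gamma_bounds, simp add: \<gamma>_def)+
  have beta_eq: "(\<beta> - 2) / (\<beta> - 1) = 1 - \<gamma>" using \<open>\<beta> > 2\<close> by (simp add: \<gamma>_def field_simps)
  have "(2::real) ^ k > 1" using \<open>k \<ge> 2\<close> by (intro one_less_power) auto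
  then have s: "0 < s" "s < 1" and c0: "c > 0" using \<open>k \<ge> 2\<close> gamma by (auto simp: s_def c_def)
  have R0: "0 \<le> R" unfolding R_def using s by (simp add: divide_nonpos_neg)
  have sR: "s powr R = 1 / 4" unfolding R_def powr_def using s by simp
  have N0: "real N > 0" using \<open>N \<ge> 1\<close> by simp
  have theta: "0 < \<theta>" "\<theta> < 1"
  proof -
    have "exp (- (2 * R * c * (2 * real N) powr \<gamma>)) \<le> 1"
      using R0 c0 by (auto intro!: mult_nonneg_nonneg)
    then show "0 < \<theta>" unfolding \<theta>_def by linarith
  qed (simp add: \<theta>_def)
  have theta': "0 < \<theta>'" "\<theta>' < 1"
    using theta N0 powr_less_mono2[of "1 / (2 * real N)" \<theta> 1] by (auto simp: \<theta>'_def)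
  obtain x where x: "x \<longlonglongrightarrow> 1" and ev: "\<forall>\<^sub>F n in sequentially. \<forall>m.
    measure_pmf.prob (ksat_pmf k n m (power_law_weight \<beta> n)) {\<Phi>. satisfiable \<Phi>}
      \<le> s ^ m * (\<Prod>i=1..n. 2 - exp (- (x n * (real m / real n) * c * (real n / real i) powr \<gamma>)))"
    using prob_power_law_satisfiable_le[OF \<open>\<beta> > 2\<close> \<gamma>_def, of k] \<open>k \<ge> 2\<close> unfolding c_def s_def by auto
  have eps: "\<epsilon> l \<longlonglongrightarrow> 0" if "l \<in> {1..N-1}" for l
    using smalloD_tendsto[OF assms(5)[OF that]] by simp
  \<comment> \<open>The sum dominates each deviation, so one null sequence serves all
    blocks.\<close>
  define e where "e n = (\<Sum>l=1..N-1. \<bar>x n - (1 + \<epsilon> l n)\<bar> * (R * c * real N powr \<gamma>))" for n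
  have "e \<longlonglongrightarrow> (\<Sum>l=1..N-1. \<bar>1 - (1 + 0)\<bar> * (R * c * real N powr \<gamma>))"
    unfolding e_def by (intro tendsto_intros x eps)
  then have "e \<longlonglongrightarrow> 0" by simp
  then have "(\<lambda>n. (1 + e n) * \<theta>') \<longlonglongrightarrow> (1 + 0) * \<theta>'" by (intro tendsto_intros)
  \<comment> \<open>\<open>(1 + \<theta>') / 2\<close> lies strictly between
    \<open>\<theta>'\<close> and 1, which leaves room for the factor \<open>1 + e n\<close>.\<close>
  then have ev_e: "\<forall>\<^sub>F n in sequentially. (1 + e n) * \<theta>' < (1 + \<theta>') / 2"
    using theta' by (intro order_tendstoD(2)) auto
  \<comment> \<open>This makes the factors in the hypothesis at least 1.\<close>
  have ev_eps: "\<forall>\<^sub>F n in sequentially. \<forall>l\<in>{1..N-1}. -1 < \<epsilon> l n"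
    using order_tendstoD(1)[OF eps, of _ "-1"] by (intro eventually_ball_finite) auto
  have ev_x: "\<forall>\<^sub>F n in sequentially. 0 < x n" "\<forall>\<^sub>F n in sequentially. x n < 2"
    using order_tendstoD[OF x] by simp_all
  have "\<forall>\<^sub>F n in sequentially. p n \<le> 2 ^ (N + 1) * ((1 + \<theta>') / 2) ^ n + (1 / 2) ^ n"
    using ev assms(6) ev_e ev_eps ev_x eventually_ge_at_top[of 1]
  proof eventually_elim
    fix n :: nat
    assume le: "\<forall>m. measure_pmf.prob (ksat_pmf k n m (power_law_weight \<beta> n)) {\<Phi>. satisfiable \<Phi>}
      \<le> s ^ m * (\<Prod>i=1..n. 2 - exp (- (x n * (real m / real n) * c * (real n / real i) powr \<gamma>)))"
      and hyp: "(1 - 1 / 2 ^ k) powr (r n) * 2 powr (1 / real N) *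
      (\<Prod>l=1..N-1.
        (2 - exp (- (1 + \<epsilon> l n) * r n * (real k / (2 ^ k - 1)) * ((\<beta> - 2) / (\<beta> - 1)) *
               (real N / real l) powr (1 / (\<beta> - 1)))) powr (1 / real N)) < 1"
      and e_le: "(1 + e n) * \<theta>' < (1 + \<theta>') / 2" and eps_ge: "\<forall>l\<in>{1..N-1}. -1 < \<epsilon> l n"
      and xn: "0 < x n" "x n < 2" and n: "1 \<le> n"
    have r0: "0 \<le> r n" by (simp add: assms(4))
    have sm: "s ^ m n = s powr (r n * real n)" using s n by (simp add: assms(4) powr_realpow)
    have p_le: "p n \<le> s powr (r n * real n) *
        (\<Prod>i=1..n. 2 - exp (- (x n * r n * c * (real n / real i) powr \<gamma>)))"
      using le[rule_format, of "m n"] unfolding p_def sm assms(4)[symmetric] .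
    show "p n \<le> 2 ^ (N + 1) * ((1 + \<theta>') / 2) ^ n + (1 / 2) ^ n"
    \<comment> \<open>The sequence \<open>r\<close> may move between both regimes, so the common
      bound is the sum of the two individual ones.\<close>
    proof (cases "r n \<le> R")
      case True
      have eps_ge': "-1 \<le> \<epsilon> l n" if "l \<in> {1..N-1}" for l
        using eps_ge that by (auto intro: less_imp_le)
      have e0: "0 \<le> e n" unfolding e_def using R0 c0 by (intro sum_nonneg mult_nonneg_nonneg) auto
      have e_ge: "\<bar>x n - (1 + \<epsilon> l n)\<bar> * (R * c * real N powr \<gamma>) \<le> e n" if "l \<in> {1..N-1}" for l
        unfolding e_def using that R0 c0 by (intro member_le_sum) (auto intro!: mult_nonneg_nonneg)
      have "s powr r n * 2 powr (1 / real N) *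
        (\<Prod>l=1..N-1. (2 - exp (- ((1 + \<epsilon> l n) * r n * c * (real N / real l) powr \<gamma>))) powr (1 / real N)) < 1"
        using hyp unfolding s_def c_def beta_eq \<gamma>_def[symmetric]
        by (simp only: mult_minus_left mult.assoc)
      then have "s powr (r n * real n) * (\<Prod>i=1..n. 2 - exp (- (x n * r n * c * (real n / real i) powr \<gamma>)))
         \<le> 2 ^ (N + 1) * ((1 + e n) * \<theta>') powr real n"
        unfolding \<theta>'_def \<theta>_def using \<open>N \<ge> 1\<close> n c0 gamma r0 True xn s eps_ge' e0 e_ge
        by (intro first_moment_blocks_le[where \<eta> = "\<lambda>l. \<epsilon> l n"]) auto
      also have "((1 + e n) * \<theta>') powr real n = ((1 + e n) * \<theta>') ^ n"
        using e0 theta' by (intro powr_realpow) auto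
      also have "2 ^ (N + 1) * \<dots> \<le> 2 ^ (N + 1) * ((1 + \<theta>') / 2) ^ n"
        using e_le e0 theta' by (intro mult_left_mono power_mono) auto
      finally show ?thesis using p_le by (simp add: add_increasing2)
    next
      case False
      have "s powr (r n * real n) \<le> s powr (R * real n)"
        using False s n by (intro powr_mono' mult_right_mono) auto
      also have "\<dots> = (s powr R) powr real n" by (simp add: powr_powr)
      also have "\<dots> = (1 / 4) ^ n" unfolding sR by (rule powr_realpow) simp
      finally have "s powr (r n * real n) \<le> (1 / 4) ^ n" .
      moreover have "(\<Prod>i=1..n. 2 - exp (- (x n * r n * c * (real n / real i) powr \<gamma>))) \<le> (\<Prod>i=1..n. 2)"
        using xn r0 c0 by (intro prod_mono) (auto intro!: mult_nonneg_nonneg intro: order_trans[of _ 1])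
      ultimately have "p n \<le> (1 / 4) ^ n * (\<Prod>i=1..n. 2)"
        using xn r0 c0 by (intro order_trans[OF p_le] mult_mono prod_nonneg)
          (auto intro!: mult_nonneg_nonneg intro: order_trans[of _ 1])
      also have "\<dots> = (1 / 2) ^ n" by (simp add: power_mult_distrib[symmetric])
      finally show ?thesis using theta' by (simp add: add_increasing)
    qed
  qed
  then have "p \<in> O(\<lambda>n. 2 ^ (N + 1) * ((1 + \<theta>') / 2) ^ n + (1 / 2) ^ n)"
    using theta' by (intro landau_o.big_mono) (auto elim!: eventually_mono simp: p_def)
  \<comment> \<open>Both terms decay exponentially, so any exponent \<open>\<delta>\<close> would
    do; 1 is taken.\<close>
  also have "(\<lambda>n. 2 ^ (N + 1) * ((1 + \<theta>') / 2) ^ n + (1 / 2) ^ n) \<in> O(\<lambda>n. real n powr (- 1))"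
  proof (rule sum_in_bigo)
    define q where "q = (1 + \<theta>') / 2"
    have q: "0 < q" "q < 1" using theta' by (auto simp: q_def)
    have "(\<lambda>n. q ^ n) \<in> O(\<lambda>n. real n powr (- 1))" using q by real_asymp
    then show "(\<lambda>n. 2 ^ (N + 1) * ((1 + \<theta>') / 2) ^ n) \<in> O(\<lambda>n. real n powr (- 1))"
      unfolding q_def by simp
    show "(\<lambda>n. (1 / 2) ^ n) \<in> O(\<lambda>n. real n powr (- 1))" by real_asymp
  qed
  finally have "p \<in> O(\<lambda>n. real n powr (- 1))" .
  moreover have "p = (\<lambda>n. 1 - measure_pmf.prob (ksat_pmf k n (m n) (power_law_weight \<beta> n)) {\<Phi>. \<not> satisfiable \<Phi>})"
  proof
    fix n
    show "p n = 1 - measure_pmf.prob (ksat_pmf k n (m n) (power_law_weight \<beta> n)) {\<Phi>. \<not> satisfiable \<Phi>}"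
      using measure_pmf.prob_compl[of "{\<Phi>. satisfiable \<Phi>}" "ksat_pmf k n (m n) (power_law_weight \<beta> n)"]
      unfolding p_def by (simp add: Compl_eq_Diff_UNIV[symmetric] Collect_neg_eq)
  qed
  ultimately show ?thesis unfolding whp_def by (intro exI[of _ 1]) simp
qed

end
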